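(* Let $G=(\mathbb N_0,w,m)$ be a birth-death chain and let $f(r):=d(0,r)=r$. Then for $0\le r<R$, $$\kappa(r,R)=\nabla_{rR}\Delta f=\frac{\Delta f(r)-\Delta f(R)}{R-r}=\frac{w(r,r+1)-w(r,r-1)}{(R-r)m(r)}-\frac{w(R,R+1)-w(R,R-1)}{(R-r)m(R)}$$ where $w(r,r-1):=0$ if $r=0$.
   Context: A graph is a triple $G=(V,w,m)$ with $V$ a countable set, $w:V\times V\to[0,\infty)$ symmetric and zero on the diagonal, and $m:V\to(0,\infty)$. Write $x\sim y$ if $w(x,y)>0$. All graphs are locally finite (for each $x$ only finitely many $y$ satisfy $x\sim y$) and connected; $d(x,y)=\inf\{n: x=x_0\sim\cdots\sim x_n=y\}$ is the combinatorial distance, which is finite by connectedness. A birth-death chain is a graph $(\mathbb N_0,w,m)$ with $w(k,n)=0$ whenever $|k-n|\neq1$ (so, by connectedness, $w(n,n+1)>0$ for all $n\geq 0$). The Laplacian is $\Delta f(x)=\frac1{m(x)}\sum_{y\in V}w(x,y)(f(y)-f(x))$, $\mathrm{Deg}(x)=\frac1{m(x)}\sum_{y}w(x,y)$, and for $x\ne y$, $\nabla_{xy}f=\frac{f(x)-f(y)}{d(x,y)}$. $Lip(1)$ is the set of $f:V\to\mathbb R$ with $|f(x)-f(y)|\le d(x,y)$ for all $x,y$. Curvature: for $x\in V$ and $\varepsilon>0$ let $m_x^\varepsilon(x)=1-\varepsilon\,\mathrm{Deg}(x)$ and $m_x^\varepsilon(y)=\varepsilon w(x,y)/m(x)$ for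 $y\neq x$; this is a finitely supported probability measure for $\varepsilon$ small. For probability measures $\mu,\nu$ on $V$, $W(\mu,\nu)=\sup_{f}\sum_{x}f(x)(\mu(x)-\nu(x))$, the supremum over bounded $f\in Lip(1)$. For $x\neq y$ let $\kappa_\varepsilon(x,y)=1-\frac{W(m_x^\varepsilon,m_y^\varepsilon)}{d(x,y)}$ and $\kappa(x,y)=\lim_{\varepsilon\to0^+}\frac1\varepsilon\kappa_\varepsilon(x,y)$ (this limit exists). *)

theory Defs
  imports "HOL-Analysis.Analysis"
begin

definition adj :: "('a \<Rightarrow> 'a \<Rightarrow> real) \<Rightarrow> 'a \<Rightarrow> 'a \<Rightarrow> bool" where
  "adj w x y \<longleftrightarrow> w x y > 0"

text \<open>The vertex set is the whole type. All graphs are locally finite and connected.\<close>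

locale weighted_graph =
  fixes w :: "'a \<Rightarrow> 'a \<Rightarrow> real" and m :: "'a \<Rightarrow> real"
  assumes countable_vertices: "countable (UNIV :: 'a set)"
    and w_nonneg: "w x y \<ge> 0"
    and w_sym: "w x y = w y x"
    and w_diag: "w x x = 0"
    and m_pos: "m x > 0"
    and locally_finite: "finite {y. adj w x y}"
    and connected_graph: "(adj w)\<^sup>*\<^sup>* x y"

locale birth_death_chain = weighted_graph w m
  for w :: "nat \<Rightarrow> nat \<Rightarrow> real" and m :: "nat \<Rightarrow> real" +
  assumes nonneighbours: "\<bar>int k - int n\<bar> \<noteq> 1 \<Longrightarrow> w k n = 0"

text \<open>The relational power \<^term>\<open>(adj w ^^ n) x y\<close> says that there is a walk
  \<open>x = x\<^sub>0 \<sim> \<dots> \<sim> x\<^sub>n = y\<close> with \<open>n\<close> steps; the set below is nonempty by connectedness.\<close>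

definition graph_dist :: "('a \<Rightarrow> 'a \<Rightarrow> real) \<Rightarrow> 'a \<Rightarrow> 'a \<Rightarrow> nat" where
  "graph_dist w x y = Inf {n. (adj w ^^ n) x y}"

text \<open>On a locally finite graph the sums over all vertices in \<open>Deg\<close> and \<open>laplacian\<close> have
  only finitely many nonzero terms.\<close>

definition Deg :: "('a \<Rightarrow> 'a \<Rightarrow> real) \<Rightarrow> ('a \<Rightarrow> real) \<Rightarrow> 'a \<Rightarrow> real" where
  "Deg w m x = 1 / m x * (\<Sum>\<^sub>\<infinity>y. w x y)"

definition laplacian ::
  "('a \<Rightarrow> 'a \<Rightarrow> real) \<Rightarrow> ('a \<Rightarrow> real) \<Rightarrow> ('a \<Rightarrow> real) \<Rightarrow> 'a \<Rightarrow> real" where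
  "laplacian w m f x = 1 / m x * (\<Sum>\<^sub>\<infinity>y. w x y * (f y - f x))"

definition gradient :: "('a \<Rightarrow> 'a \<Rightarrow> real) \<Rightarrow> 'a \<Rightarrow> 'a \<Rightarrow> ('a \<Rightarrow> real) \<Rightarrow> real" where
  "gradient w x y f = (f x - f y) / real (graph_dist w x y)"

definition Lip1 :: "('a \<Rightarrow> 'a \<Rightarrow> real) \<Rightarrow> ('a \<Rightarrow> real) set" where
  "Lip1 w = {f. \<forall>x y. \<bar>f x - f y\<bar> \<le> real (graph_dist w x y)}"

text \<open>Measures on the vertex set are represented by their point masses. The function
  \<open>lazy_step w m \<epsilon> x\<close> is a probability mass function only for \<open>0 \<le> \<epsilon>\<close> with
  \<open>\<epsilon> * Deg w m x \<le> 1\<close>, which is all that matters for the limit \<open>\<epsilon> \<rightarrow> 0+\<close>.\<close>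

definition lazy_step ::
  "('a \<Rightarrow> 'a \<Rightarrow> real) \<Rightarrow> ('a \<Rightarrow> real) \<Rightarrow> real \<Rightarrow> 'a \<Rightarrow> 'a \<Rightarrow> real" where
  "lazy_step w m \<epsilon> x y = (if y = x then 1 - \<epsilon> * Deg w m x else \<epsilon> * w x y / m x)"

definition wasserstein ::
  "('a \<Rightarrow> 'a \<Rightarrow> real) \<Rightarrow> ('a \<Rightarrow> real) \<Rightarrow> ('a \<Rightarrow> real) \<Rightarrow> real" where
  "wasserstein w \<mu> \<nu> =
     (SUP f\<in>{f \<in> Lip1 w. bounded (range f)}. \<Sum>\<^sub>\<infinity>x. f x * (\<mu> x - \<nu> x))"

definition curvature_eps ::
  "('a \<Rightarrow> 'a \<Rightarrow> real) \<Rightarrow> ('a \<Rightarrow> real) \<Rightarrow> real \<Rightarrow> 'a \<Rightarrow> 'a \<Rightarrow> real" where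
  "curvature_eps w m \<epsilon> x y =
     1 - wasserstein w (lazy_step w m \<epsilon> x) (lazy_step w m \<epsilon> y) / real (graph_dist w x y)"

definition curvature ::
  "('a \<Rightarrow> 'a \<Rightarrow> real) \<Rightarrow> ('a \<Rightarrow> real) \<Rightarrow> 'a \<Rightarrow> 'a \<Rightarrow> real" where
  "curvature w m x y = Lim (at_right 0) (\<lambda>\<epsilon>. 1 / \<epsilon> * curvature_eps w m \<epsilon> x y)"

end

theory Submission
  imports Defs
begin

text \<open>For small \<open>\<epsilon>\<close> the Wasserstein distance is attained by a bounded truncation of
  \<open>- f\<close>: integrating \<open>g\<close> against the lazy step gives \<open>g + \<epsilon> \<Delta>g\<close>, so the functional to be
  maximized is \<open>g r - g R + \<epsilon> (\<Delta>g r - \<Delta>g R)\<close>. In terms of the decrements of \<open>g\<close>, which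
  lie in \<open>[-1, 1]\<close>, it is linear with coefficients that are nonnegative as soon as
  \<open>\<epsilon> (w R (R - 1) / m R + w r (r + 1) / m r) \<le> 1\<close>, so it is largest when all of
  them are \<open>1\<close>. Hence \<open>1 / \<epsilon> * \<kappa>\<^sub>\<epsilon>\<close> is constant near \<open>0\<close>.\<close>

lemma has_sum_diff:
  fixes f g :: "'a \<Rightarrow> 'b::topological_ab_group_add"
  assumes "(f has_sum a) A" and "(g has_sum b) A"
  shows "((\<lambda>x. f x - g x) has_sum a - b) A"
  using has_sum_add[OF assms(1), of "\<lambda>x. - g x" "- b"] assms(2) by (simp add: has_sum_uminus)

context weighted_graph
begin

text \<open>By local finiteness only finitely many terms are nonzero, so the sum may be split and
  rearranged for every \<open>g\<close>, bounded or not.\<close>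

lemma has_sum_weights: "((\<lambda>y. w x y * g y) has_sum (\<Sum>\<^sub>\<infinity>y. w x y * g y)) UNIV"
proof (rule has_sum_infsum)
  have "w x y = 0" if "\<not> adj w x y" for y
    using w_nonneg[of x y] that unfolding adj_def by linarith
  then have "(\<lambda>y. w x y * g y) summable_on UNIV \<longleftrightarrow> (\<lambda>y. w x y * g y) summable_on {y. adj w x y}"
    by (intro summable_on_cong_neutral) auto
  then show "(\<lambda>y. w x y * g y) summable_on UNIV"
    using locally_finite by simp
qed

lemma laplacian_eq_infsum_minus_Deg:
  "laplacian w m g x = (\<Sum>\<^sub>\<infinity>y. w x y * g y) / m x - g x * Deg w m x"
proof -
  have "((\<lambda>y. w x y * g y - w x y * g x) has_sum
      (\<Sum>\<^sub>\<infinity>y. w x y * g y) - (\<Sum>\<^sub>\<infinity>y. w x y) * g x) UNIV"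
    using has_sum_weights[of x "\<lambda>_. 1"]
    by (intro has_sum_diff has_sum_weights has_sum_cmult_left) simp
  then have "(\<Sum>\<^sub>\<infinity>y. w x y * (g y - g x)) = (\<Sum>\<^sub>\<infinity>y. w x y * g y) - (\<Sum>\<^sub>\<infinity>y. w x y) * g x"
    by (intro infsumI) (simp add: right_diff_distrib)
  then show ?thesis
    by (simp add: laplacian_def Deg_def diff_divide_distrib mult.commute)
qed

lemma has_sum_lazy_step:
  "((\<lambda>y. g y * lazy_step w m \<epsilon> x y) has_sum g x + \<epsilon> * laplacian w m g x) UNIV"
proof -
  \<comment> \<open>The mass kept at \<open>x\<close> is split off. As \<open>w x x = 0\<close>, the
    rest is \<open>\<epsilon> * w x y / m x\<close> at every \<open>y\<close>, including
    \<open>y = x\<close>.\<close>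
  have "((\<lambda>y. if y = x then g x * (1 - \<epsilon> * Deg w m x) else 0) has_sum
      g x * (1 - \<epsilon> * Deg w m x)) UNIV"
    by (rule has_sum_finite_neutralI[of "{x}"]) auto
  from has_sum_add[OF this has_sum_cmult_right[OF has_sum_weights[of x g], of "\<epsilon> / m x"]]
  have "((\<lambda>y. g y * lazy_step w m \<epsilon> x y) has_sum
      g x * (1 - \<epsilon> * Deg w m x) + \<epsilon> / m x * (\<Sum>\<^sub>\<infinity>y. w x y * g y)) UNIV"
    by (rule has_sum_cong[THEN iffD1, rotated]) (auto simp: lazy_step_def w_diag)
  then show ?thesis
    by (simp add: laplacian_eq_infsum_minus_Deg algebra_simps)
qed

lemma infsum_lazy_step_diff:
  "(\<Sum>\<^sub>\<infinity>z. g z * (lazy_step w m \<epsilon> x z - lazy_step w m \<epsilon> y z))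
    = g x - g y + \<epsilon> * (laplacian w m g x - laplacian w m g y)"
  using infsumI[OF has_sum_diff[OF has_sum_lazy_step[of g \<epsilon> x] has_sum_lazy_step[of g \<epsilon> y]]]
  by (simp add: algebra_simps)

end

context birth_death_chain
begin

lemma adj_Suc: "adj w n (Suc n)"
proof (rule ccontr)
  assume no_edge: "\<not> adj w n (Suc n)"
  \<comment> \<open>Edges change the vertex by exactly one, so without the edge from
    \<open>n\<close> to \<open>Suc n\<close> no walk leaves the vertices up to
    \<open>n\<close>.\<close>
  have "(adj w)\<^sup>*\<^sup>* n k \<Longrightarrow> k \<le> n" for k
  proof (induction rule: rtranclp_induct)
    case (step y z)
    have "\<bar>int y - int z\<bar> = 1"
      using step.hyps(2) nonneighbours[of y z] unfolding adj_def by fastforce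
    moreover have "\<not> (y = n \<and> z = Suc n)"
      using step.hyps(2) no_edge by blast
    ultimately show ?case
      using step.IH by linarith
  qed simp
  then show False
    using connected_graph[of n "Suc n"] by fastforce
qed

lemma graph_dist_eq: "graph_dist w x y = nat \<bar>int x - int y\<bar>"
proof -
  have lower: "nat \<bar>int x - int y\<bar> \<le> n" if "(adj w ^^ n) x y" for n
    using that
  proof (induction n arbitrary: y)
    case (Suc n)
    then obtain z where z: "(adj w ^^ n) x z" "adj w z y"
      by auto
    have "\<bar>int z - int y\<bar> = 1"
      using z(2) nonneighbours[of z y] unfolding adj_def by fastforce
    then show ?case
      using Suc.IH[OF z(1)] by linarith
  qed simp
  have up: "(adj w ^^ n) k (k + n)" for n k
    using adj_Suc by (induction n) auto
  have down: "(adj w ^^ n) (k + n) k" for n k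
  proof (induction n)
    case (Suc n)
    have "adj w (k + Suc n) (k + n)"
      using adj_Suc[of "k + n"] w_sym[of "k + n"] by (simp add: adj_def)
    then show ?case
      using Suc.IH by (rule relpowp_Suc_I2)
  qed simp
  have "(adj w ^^ nat \<bar>int x - int y\<bar>) x y"
  proof (cases "x \<le> y")
    case True
    then have "nat \<bar>int x - int y\<bar> = y - x"
      by linarith
    then show ?thesis
      using up[of "y - x" x] True by simp
  next
    case False
    then have "nat \<bar>int x - int y\<bar> = x - y"
      by linarith
    then show ?thesis
      using down[of "x - y" y] False by simp
  qed
  then show ?thesis
    unfolding graph_dist_def by (intro cInf_eq_minimum) (auto dest: lower)
qed

text \<open>At \<open>x = 0\<close> the truncated \<open>x - 1\<close> is harmless, because \<open>w 0 0 = 0\<close>.\<close>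

lemma laplacian_eq:
  "laplacian w m g x
    = (w x (x + 1) * (g (x + 1) - g x) + w x (x - 1) * (g (x - 1) - g x)) / m x"
proof -
  have "w x y = 0" if "y \<notin> {x - 1, x + 1}" for y
    using that by (intro nonneighbours) auto
  then have "(\<Sum>\<^sub>\<infinity>y. w x y * (g y - g x)) = (\<Sum>\<^sub>\<infinity>y\<in>{x - 1, x + 1}. w x y * (g y - g x))"
    by (intro infsum_cong_neutral) auto
  then show ?thesis
    by (simp add: laplacian_def add.commute)
qed

lemma laplacian_real: "laplacian w m real x = (w x (x + 1) - w x (x - 1)) / m x"
  by (cases x) (simp_all add: laplacian_eq w_diag)

text \<open>Call one minus the decrement of \<open>g\<close> along an edge its slack. The right side
  minus the left is the total slack between \<open>r\<close> and \<open>R\<close>, minus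
  \<open>\<epsilon>\<close> times the weighted slacks of the two end edges inside that interval,
  plus \<open>\<epsilon>\<close> times those of the edges just outside.\<close>

lemma Lip1_functional_le:
  assumes "g \<in> Lip1 w" and "r < R" and "\<epsilon> > 0"
    and small: "\<epsilon> * (w R (R - 1) / m R + w r (r + 1) / m r) \<le> 1"
  shows "g r - g R + \<epsilon> * (laplacian w m g r - laplacian w m g R)
    \<le> real R - real r + \<epsilon> * (laplacian w m real R - laplacian w m real r)"
proof -
  have lip: "g x - g y \<le> \<bar>real x - real y\<bar>" for x y
  proof -
    have "real (graph_dist w x y) = \<bar>real x - real y\<bar>"
      by (simp add: graph_dist_eq)
    then show ?thesis
      using assms(1) unfolding Lip1_def by (smt (verit) mem_Collect_eq)
  qed
  define D where "D = real R - real r - (g r - g R)"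
  define p where "p = w R (R - 1) / m R"
  define q where "q = w r (r + 1) / m r"
  define p' where "p' = w R (R + 1) / m R"
  define q' where "q' = w r (r - 1) / m r"
  have nonneg: "p \<ge> 0" "q \<ge> 0" "p' \<ge> 0" "q' \<ge> 0"
    unfolding p_def q_def p'_def q'_def using w_nonneg m_pos by (simp_all add: less_imp_le)
  have "D \<ge> 0"
    using lip[of r R] \<open>r < R\<close> by (simp add: D_def)
  \<comment> \<open>\<open>D\<close> sums the nonnegative slacks from \<open>r\<close> to
    \<open>R\<close>, so it dominates each one. If \<open>R = r + 1\<close>, both end edges are the
    same edge and \<open>D\<close> pays for both terms, which is why the smallness condition bounds
    \<open>p + q\<close>.\<close>
  have "1 - (g (R - 1) - g R) \<le> D"
    using lip[of r "R - 1"] \<open>r < R\<close> by (simp add: D_def of_nat_diff)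
  moreover have "1 - (g r - g (r + 1)) \<le> D"
    using lip[of "r + 1" R] \<open>r < R\<close> by (simp add: D_def)
  ultimately have "\<epsilon> * (p * (1 - (g (R - 1) - g R)) + q * (1 - (g r - g (r + 1)))) \<le> \<epsilon> * (p * D + q * D)"
    using nonneg \<open>\<epsilon> > 0\<close> by (intro mult_left_mono add_mono) auto
  also have "\<dots> = \<epsilon> * (p + q) * D"
    by (simp add: algebra_simps)
  also have "\<dots> \<le> 1 * D"
    using small \<open>D \<ge> 0\<close> unfolding p_def q_def by (intro mult_right_mono)
  finally have inner: "\<epsilon> * (p * (1 - (g (R - 1) - g R)) + q * (1 - (g r - g (r + 1)))) \<le> D"
    by simp
  \<comment> \<open>For \<open>r = 0\<close> the second difference is 0, since then
    \<open>r - 1 = r\<close>.\<close>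
  have "g R - g (R + 1) \<le> 1" "g (r - 1) - g r \<le> 1"
    using lip[of R "R + 1"] lip[of "r - 1" r] by (cases r; simp)+
  then have outer: "0 \<le> \<epsilon> * (p' * (1 - (g R - g (R + 1))) + q' * (1 - (g (r - 1) - g r)))"
    using nonneg \<open>\<epsilon> > 0\<close> by simp
  have laplacians: "laplacian w m g r = q * (g (r + 1) - g r) + q' * (g (r - 1) - g r)"
    "laplacian w m g R = p' * (g (R + 1) - g R) + p * (g (R - 1) - g R)"
    "laplacian w m real r = q - q'" "laplacian w m real R = p' - p"
    unfolding laplacian_real unfolding laplacian_eq p_def q_def p'_def q'_def
    by (simp_all add: add_divide_distrib diff_divide_distrib)
  then show ?thesis
    using inner outer unfolding laplacians D_def by (simp add: algebra_simps)
qed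

lemma wasserstein_lazy_step:
  assumes "r < R" and "\<epsilon> > 0"
    and small: "\<epsilon> * (w R (R - 1) / m R + w r (r + 1) / m r) \<le> 1"
  shows "wasserstein w (lazy_step w m \<epsilon> r) (lazy_step w m \<epsilon> R)
    = real R - real r + \<epsilon> * (laplacian w m real R - laplacian w m real r)"
proof -
  \<comment> \<open>Cutting off at \<open>R + 1\<close> rather than at \<open>R\<close> leaves
    \<open>- real\<close> unchanged at all neighbours of \<open>r\<close> and \<open>R\<close>,
    hence also both Laplacians.\<close>
  define g where "g n = - real (min n (R + 1))" for n
  have "g \<in> Lip1 w"
    by (auto simp: Lip1_def graph_dist_eq g_def min_def)
  moreover have "bounded (range g)"
    by (auto simp: bounded_iff g_def intro!: exI[of _ "real (R + 1)"])
  moreover have "laplacian w m g x = - laplacian w m real x" if "x \<le> R" for x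
  proof -
    have "g (x + 1) = - real (x + 1)" "g x = - real x" "g (x - 1) = - real (x - 1)"
      using that by (auto simp: g_def)
    then show ?thesis
      unfolding laplacian_eq by (simp add: algebra_simps add_divide_distrib diff_divide_distrib)
  qed
  then have "g r - g R + \<epsilon> * (laplacian w m g r - laplacian w m g R)
      = real R - real r + \<epsilon> * (laplacian w m real R - laplacian w m real r)"
    using \<open>r < R\<close> by (simp add: g_def)
  ultimately show ?thesis
    unfolding wasserstein_def infsum_lazy_step_diff
    by (intro cSup_eq_maximum) (auto intro!: image_eqI[of _ _ g] Lip1_functional_le assms)
qed

lemma curvature_eps_eq:
  assumes "r < R" and "\<epsilon> > 0"
    and "\<epsilon> * (w R (R - 1) / m R + w r (r + 1) / m r) \<le> 1"
  shows "1 / \<epsilon> * curvature_eps w m \<epsilon> r R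
    = (laplacian w m real r - laplacian w m real R) / (real R - real r)"
  using assms
  by (simp add: curvature_eps_def wasserstein_lazy_step graph_dist_eq field_simps)

lemma curvature_tendsto:
  assumes "r < R"
  shows "((\<lambda>\<epsilon>. 1 / \<epsilon> * curvature_eps w m \<epsilon> r R) \<longlongrightarrow>
    (laplacian w m real r - laplacian w m real R) / (real R - real r)) (at_right 0)"
proof (rule tendsto_eventually)
  define c where "c = w R (R - 1) / m R + w r (r + 1) / m r"
  have "((\<lambda>\<epsilon>. \<epsilon> * c) \<longlongrightarrow> 0 * c) (at_right 0)"
    by (intro tendsto_intros)
  \<comment> \<open>Near 0 the smallness condition thus holds, and the quotient already equals its
    limit there.\<close>
  then have "\<forall>\<^sub>F \<epsilon> in at_right 0. \<epsilon> * c < 1"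
    by (rule order_tendstoD) simp
  with eventually_at_right_less[of 0]
  show "\<forall>\<^sub>F \<epsilon> in at_right 0. 1 / \<epsilon> * curvature_eps w m \<epsilon> r R
      = (laplacian w m real r - laplacian w m real R) / (real R - real r)"
    by eventually_elim (rule curvature_eps_eq[OF assms], auto simp: c_def)
qed

end

theorem theorem2p10:
  fixes w :: "nat \<Rightarrow> nat \<Rightarrow> real" and m f :: "nat \<Rightarrow> real" and r R :: nat
  assumes "birth_death_chain w m"
    and "\<And>n. f n = real (graph_dist w 0 n)"
    and "r < R"
  shows "(\<forall>n. f n = real n)
    \<and> ((\<lambda>\<epsilon>. 1 / \<epsilon> * curvature_eps w m \<epsilon> r R) \<longlongrightarrow> curvature w m r R) (at_right 0)
    \<and> curvature w m r R = gradient w r R (laplacian w m f)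
    \<and> gradient w r R (laplacian w m f)
        = (laplacian w m f r - laplacian w m f R) / (real R - real r)
    \<and> (laplacian w m f r - laplacian w m f R) / (real R - real r)
        = (w r (r + 1) - (if r = 0 then 0 else w r (r - 1))) / ((real R - real r) * m r)
          - (w R (R + 1) - w R (R - 1)) / ((real R - real r) * m R)"
proof -
  interpret birth_death_chain w m
    by fact
  have f: "f = real"
    using assms(2) by (auto simp: graph_dist_eq)
  let ?L = "(laplacian w m f r - laplacian w m f R) / (real R - real r)"
  have lim: "((\<lambda>\<epsilon>. 1 / \<epsilon> * curvature_eps w m \<epsilon> r R) \<longlongrightarrow> ?L) (at_right 0)"
    unfolding f using \<open>r < R\<close> by (rule curvature_tendsto)
  then have curv: "curvature w m r R = ?L"
    unfolding curvature_def by (intro tendsto_Lim) simp_all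
  have grad: "gradient w r R (laplacian w m f) = ?L"
    using \<open>r < R\<close> by (simp add: gradient_def graph_dist_eq)
  \<comment> \<open>The convention at \<open>r = 0\<close> agrees with truncated subtraction, as
    \<open>w 0 0 = 0\<close>.\<close>
  have "(if r = 0 then 0 else w r (r - 1)) = w r (r - 1)"
    by (simp add: w_diag)
  then have "?L = (w r (r + 1) - (if r = 0 then 0 else w r (r - 1))) / ((real R - real r) * m r)
      - (w R (R + 1) - w R (R - 1)) / ((real R - real r) * m R)"
    unfolding f laplacian_real by (simp add: diff_divide_distrib mult.commute)
  then show ?thesis
    using lim curv grad f by simp
qed

end
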